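(* For all integers $n\geq 2$ and $k\geq 1$ we have $L_n^{(k+1)}\succ L_n^{(k)}$, i.e. $L_n^{(k+1)}$ strictly stochastically dominates $L_n^{(k)}$: $\mathbb P(L^{(k)}_n\geq r)\leq \mathbb P(L^{(k+1)}_n\geq r)$ for every integer $r$, with strict inequality for at least one $r$.
   Context: For integers $n\geq 2$ and $k\geq 1$, suppose $n$ passengers board $k$ buses, each passenger independently choosing one of the $k$ buses uniformly at random. A passenger is called lonely if no other passenger boards the same bus. Let the random variable $L^{(k)}_n$ be the number of lonely passengers when $n$ passengers board $k$ buses in this way. For integer-valued random variables $X,Y$, the notation $Y\succ X$ (equivalently $X\prec Y$) denotes strict stochastic dominance: $\mathbb P(X\geq r)\leq\mathbb P(Y\geq r)$ for each $r$, with strict inequality for at least one $r$. *)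

theory Defs
  imports "HOL-Probability.Probability" "HOL-Probability.Product_PMF"
begin

text \<open>
  Passengers are \<open>0, \<dots>, n - 1\<close> and buses are \<open>0, \<dots>, k - 1\<close>; a boarding is a function
  from passengers to buses, with default value \<open>0\<close> outside \<open>{..<n}\<close>.
  For \<open>k = 0\<close> the distribution \<open>pmf_of_set {..<k}\<close> is unspecified, so the definitions
  are only meaningful for \<open>k \<ge> 1\<close>.
\<close>

definition boarding :: "nat \<Rightarrow> nat \<Rightarrow> (nat \<Rightarrow> nat) pmf" where
  "boarding n k = Pi_pmf {..<n} 0 (\<lambda>_. pmf_of_set {..<k})"

definition lonely :: "nat \<Rightarrow> (nat \<Rightarrow> nat) \<Rightarrow> nat \<Rightarrow> bool" where
  "lonely n f i \<longleftrightarrow> i < n \<and> (\<forall>j<n. j \<noteq> i \<longrightarrow> f j \<noteq> f i)"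

definition num_lonely :: "nat \<Rightarrow> (nat \<Rightarrow> nat) \<Rightarrow> int" where
  "num_lonely n f = int (card {i. lonely n f i})"

definition L :: "nat \<Rightarrow> nat \<Rightarrow> int pmf" where
  "L n k = map_pmf (num_lonely n) (boarding n k)"

text \<open>
  Stochastic dominance depends only on the distributions of the two random variables, which
  need not live on a common probability space; it is therefore stated for distributions.
\<close>

definition strictly_dominates :: "int pmf \<Rightarrow> int pmf \<Rightarrow> bool"  (infix \<open>\<succ>\<close> 50) where
  "Y \<succ> X \<longleftrightarrow>
     (\<forall>r. measure_pmf.prob X {r..} \<le> measure_pmf.prob Y {r..}) \<and>
     (\<exists>r. measure_pmf.prob X {r..} < measure_pmf.prob Y {r..})"

end

(*
  The laws of L n k are ordered in k by monotone likelihood ratio, which implies dominance.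
  With g = exp(x) - 1 - x, the probability of i nonempty buses and r lonely passengers is, up to
  factors depending only on n and k,
    1/(k-i)! * [x^(n-r)] g^(i-r) / (r! (i-r)!),
  so by the Cauchy-Binet formula (for 2x2 minors) it is enough that 1/(k-i)! is totally positive of
  order two in (k,i) and that the remaining factor is so in (i,r). These follow from
  the log-concavity of 1/m! and of the coefficients of powers of g, respectively. Dominance is strict because the laws differ: the mean
  n (1 - 1/k)^(n-1) is strictly increasing in k.
*)
theory Submission
  imports Defs
begin

section \<open>Totally positive kernels of order two\<close>

definition tp2 :: "(nat \<Rightarrow> nat \<Rightarrow> real) \<Rightarrow> bool" where
  "tp2 F \<longleftrightarrow> (\<forall>u u' v v'. u \<le> u' \<longrightarrow> v \<le> v' \<longrightarrow> F u v' * F u' v \<le> F u v * F u' v')"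

lemma tp2D: "tp2 F \<Longrightarrow> u \<le> u' \<Longrightarrow> v \<le> v' \<Longrightarrow> F u v' * F u' v \<le> F u v * F u' v'"
  by (simp add: tp2_def)

text \<open>Cauchy-Binet: twice the 2x2 minor of the composite is a sum over all pairs
  \<open>w\<close>, \<open>w'\<close> of a minor of \<open>F\<close> times a minor of
  \<open>G\<close>. Exchanging \<open>w\<close> and \<open>w'\<close> flips both signs, so no
  summand is negative.\<close>

lemma tp2_compose:
  assumes F: "tp2 F" and G: "tp2 G" and "u \<le> u'" "v \<le> v'"
  shows "(\<Sum>w\<in>W. F u w * G w v') * (\<Sum>w\<in>W. F u' w * G w v)
       \<le> (\<Sum>w\<in>W. F u w * G w v) * (\<Sum>w\<in>W. F u' w * G w v')"
proof -
  define f where "f = (\<lambda>w w'. F u w * F u' w')"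
  define g where "g = (\<lambda>w w'. G w v * G w' v' - G w v' * G w' v)"
  let ?D = "(\<Sum>w\<in>W. F u w * G w v) * (\<Sum>w\<in>W. F u' w * G w v')
          - (\<Sum>w\<in>W. F u w * G w v') * (\<Sum>w\<in>W. F u' w * G w v)"
  have D: "?D = (\<Sum>w\<in>W. \<Sum>w'\<in>W. f w w' * g w w')"
    by (simp add: sum_product f_def g_def sum_subtractf [symmetric] algebra_simps)
  \<comment> \<open>Renaming and the antisymmetry of \<open>g\<close> give a second expression for
    \<open>?D\<close>; adding the two antisymmetrizes \<open>f\<close>.\<close>
  also have "\<dots> = (\<Sum>w\<in>W. \<Sum>w'\<in>W. f w' w * g w' w)"
    by (rule sum.swap)
  also have "\<dots> = - (\<Sum>w\<in>W. \<Sum>w'\<in>W. f w' w * g w w')"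
    by (simp add: g_def sum_negf [symmetric] algebra_simps)
  finally have "2 * ?D = (\<Sum>w\<in>W. \<Sum>w'\<in>W. (f w w' - f w' w) * g w w')"
    using D by (simp add: left_diff_distrib sum_subtractf)
  also have "\<dots> \<ge> 0"
  proof (intro sum_nonneg)
    fix w w'
    show "0 \<le> (f w w' - f w' w) * g w w'"
    proof (cases "w \<le> w'")
      case True
      have "0 \<le> f w w' - f w' w" "0 \<le> g w w'"
        using tp2D[OF F \<open>u \<le> u'\<close> True] tp2D[OF G True \<open>v \<le> v'\<close>]
        by (simp_all add: f_def g_def)
      then show ?thesis by simp
    next
      case False
      then have le: "w' \<le> w" by simp
      have "f w w' - f w' w \<le> 0" "g w w' \<le> 0"
        using tp2D[OF F \<open>u \<le> u'\<close> le] tp2D[OF G le \<open>v \<le> v'\<close>]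
        by (simp_all add: f_def g_def mult.commute)
      then show ?thesis by (rule mult_nonpos_nonpos)
    qed
  qed
  finally show ?thesis by simp
qed

text \<open>A nonnegative sequence \<open>f\<close> is log-concave without internal zeros iff \<open>toeplitz f\<close> is \<open>tp2\<close>.\<close>

definition toeplitz :: "(nat \<Rightarrow> real) \<Rightarrow> nat \<Rightarrow> nat \<Rightarrow> real" where
  "toeplitz f u v = (if v \<le> u then f (u - v) else 0)"

lemma toeplitz_0 [simp]: "toeplitz f u 0 = f u"
  by (simp add: toeplitz_def)

text \<open>Condition \<open>lc\<close> is log-concavity in gap form: for a fixed sum of the
  arguments, the product does not drop as they move inward.\<close>

lemma tp2_toeplitzI:
  assumes nn: "\<And>i. 0 \<le> f i"
    and lc: "\<And>a b m. a \<le> b \<Longrightarrow> f a * f (b + m) \<le> f (a + m) * f b"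
  shows "tp2 (toeplitz f)"
  unfolding tp2_def
proof (intro allI impI)
  fix u u' v v' :: nat
  assume le: "u \<le> u'" "v \<le> v'"
  show "toeplitz f u v' * toeplitz f u' v \<le> toeplitz f u v * toeplitz f u' v'"
  proof (cases "v' \<le> u")
    case True
    have "f (u - v') * f ((u' - v') + (v' - v)) \<le> f ((u - v') + (v' - v)) * f (u' - v')"
      by (rule lc) (use le in simp)
    then show ?thesis using True le by (simp add: toeplitz_def)
  next
    case False
    then show ?thesis using nn by (simp add: toeplitz_def)
  qed
qed

text \<open>The Cauchy product becomes a product of lower triangular matrices. The bound
  \<open>M\<close> is left free so that rows \<open>u\<close> and \<open>u'\<close> can be summed
  over one index set.\<close>

lemma toeplitz_fps_mult:
  assumes "u \<le> M"
  shows "toeplitz (fps_nth (a * b)) u v = (\<Sum>w\<le>M. toeplitz (fps_nth a) u w * toeplitz (fps_nth b) w v)"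
proof (cases "v \<le> u")
  case False
  then show ?thesis by (subst sum.neutral) (auto simp: toeplitz_def)
next
  case True
  have "(\<Sum>w\<le>M. toeplitz (fps_nth a) u w * toeplitz (fps_nth b) w v)
      = (\<Sum>w\<in>{v..u}. fps_nth a (u - w) * fps_nth b (w - v))"
    using assms by (intro sum.mono_neutral_cong_right) (auto simp: toeplitz_def)
  also have "\<dots> = (\<Sum>i=0..u - v. fps_nth a i * fps_nth b (u - v - i))"
    by (rule sum.reindex_bij_witness[where i = "\<lambda>i. u - i" and j = "\<lambda>w. u - w"])
       (use True in auto)
  finally show ?thesis using True by (simp add: toeplitz_def fps_mult_nth)
qed

section \<open>Coefficients of powers of a log-concave series\<close>

lemma fps_nth_power_nonneg:
  fixes a :: "real fps"
  assumes "\<And>i. 0 \<le> fps_nth a i"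
  shows "0 \<le> fps_nth (a ^ j) i"
proof (induction j arbitrary: i)
  case (Suc j)
  then show ?case using assms by (auto simp: fps_mult_nth intro!: sum_nonneg)
qed simp

lemma tp2_toeplitz_power:
  fixes a :: "real fps"
  assumes "tp2 (toeplitz (fps_nth a))"
  shows "tp2 (toeplitz (fps_nth (a ^ j)))"
proof (induction j)
  case 0
  show ?case by (rule tp2_toeplitzI) auto
next
  case (Suc j)
  show ?case unfolding tp2_def
  proof (intro allI impI)
    fix u u' v v' :: nat
    assume le: "u \<le> u'" "v \<le> v'"
    note T = toeplitz_fps_mult[of _ u' a "a ^ j"]
    show "toeplitz (fps_nth (a ^ Suc j)) u v' * toeplitz (fps_nth (a ^ Suc j)) u' v
        \<le> toeplitz (fps_nth (a ^ Suc j)) u v * toeplitz (fps_nth (a ^ Suc j)) u' v'"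
      unfolding power_Suc T[OF le(1)] T[OF order_refl]
      by (rule tp2_compose[OF assms Suc.IH le])
  qed
qed

text \<open>Splitting \<open>a ^ j'\<close> as \<open>a ^ j * a ^ (j' - j)\<close> makes its
  coefficients nonnegative combinations of the columns \<open>m\<close> of the Toeplitz matrix of
  \<open>a ^ j\<close>; each column is compared with column 0.\<close>

lemma fps_nth_power_tp2:
  fixes a :: "real fps"
  assumes nn: "\<And>i. 0 \<le> fps_nth a i" and tp: "tp2 (toeplitz (fps_nth a))"
    and MN: "M \<le> N" and j: "j \<le> j'"
  shows "fps_nth (a ^ j') M * fps_nth (a ^ j) N \<le> fps_nth (a ^ j) M * fps_nth (a ^ j') N"
proof -
  let ?T = "toeplitz (fps_nth (a ^ j))"
  have conv: "fps_nth (a ^ j') u = (\<Sum>m\<le>N. ?T u m * fps_nth (a ^ (j' - j)) m)" if "u \<le> N" for u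
    using toeplitz_fps_mult[OF that, of "a ^ j" "a ^ (j' - j)" 0] j
    by (simp add: power_add [symmetric])
  have "fps_nth (a ^ j') M * fps_nth (a ^ j) N
      = (\<Sum>m\<le>N. fps_nth (a ^ (j' - j)) m * (?T M m * ?T N 0))"
    unfolding conv[OF MN] by (simp add: sum_distrib_left sum_distrib_right mult_ac)
  also have "\<dots> \<le> (\<Sum>m\<le>N. fps_nth (a ^ (j' - j)) m * (?T M 0 * ?T N m))"
    by (intro sum_mono mult_left_mono tp2D[OF tp2_toeplitz_power[OF tp]]
          fps_nth_power_nonneg nn MN) simp
  also have "\<dots> = fps_nth (a ^ j) M * fps_nth (a ^ j') N"
    unfolding conv[OF order_refl] by (simp add: sum_distrib_left sum_distrib_right mult_ac)
  finally show ?thesis .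
qed

text \<open>Needed for \<open>occ\<close>, where raising \<open>r\<close> lowers exponent and degree
  together. The factor \<open>a ^ t\<close> is split off and \<open>fps_nth_power_tp2\<close>
  compares the rest term by term.\<close>

lemma fps_nth_power_diagonal:
  fixes a :: "real fps"
  assumes nn: "\<And>i. 0 \<le> fps_nth a i" and tp: "tp2 (toeplitz (fps_nth a))"
    and a0: "fps_nth a 0 = 0"
    and t: "t \<le> j" "t \<le> N" and j: "j \<le> j'"
  shows "fps_nth (a ^ j') N * fps_nth (a ^ (j - t)) (N - t)
       \<le> fps_nth (a ^ j) N * fps_nth (a ^ (j' - t)) (N - t)"
proof -
  have conv: "fps_nth (a ^ i) N = (\<Sum>m=0..N. fps_nth (a ^ t) m * fps_nth (a ^ (i - t)) (N - m))"
    if "t \<le> i" for i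
    using that by (simp add: fps_mult_nth [symmetric] power_add [symmetric])
  have tj': "t \<le> j'" using t j by simp
  have "fps_nth (a ^ j') N * fps_nth (a ^ (j - t)) (N - t)
      = (\<Sum>m=0..N. fps_nth (a ^ t) m * (fps_nth (a ^ (j' - t)) (N - m) * fps_nth (a ^ (j - t)) (N - t)))"
    unfolding conv[OF tj'] sum_distrib_right by (simp add: mult_ac)
  also have "\<dots> \<le> (\<Sum>m=0..N. fps_nth (a ^ t) m * (fps_nth (a ^ (j - t)) (N - m) * fps_nth (a ^ (j' - t)) (N - t)))"
  proof (rule sum_mono)
    fix m assume "m \<in> {0..N}"
    show "fps_nth (a ^ t) m * (fps_nth (a ^ (j' - t)) (N - m) * fps_nth (a ^ (j - t)) (N - t))
        \<le> fps_nth (a ^ t) m * (fps_nth (a ^ (j - t)) (N - m) * fps_nth (a ^ (j' - t)) (N - t))"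
    \<comment> \<open>Without a constant term in \<open>a\<close>, the power \<open>a ^ t\<close>
      starts at degree \<open>t\<close>; and \<open>m >= t\<close> gives
      \<open>N - m <= N - t\<close>, as the comparison requires.\<close>
    proof (cases "m < t")
      case True
      then show ?thesis using startsby_zero_power_prefix[OF a0, of t] by simp
    next
      case False
      have "fps_nth (a ^ (j' - t)) (N - m) * fps_nth (a ^ (j - t)) (N - t)
          \<le> fps_nth (a ^ (j - t)) (N - m) * fps_nth (a ^ (j' - t)) (N - t)"
        by (rule fps_nth_power_tp2[OF nn tp]) (use False j in auto)
      then show ?thesis by (intro mult_left_mono fps_nth_power_nonneg nn)
    qed
  qed
  also have "\<dots> = fps_nth (a ^ j) N * fps_nth (a ^ (j' - t)) (N - t)"
    unfolding conv[OF t(1)] sum_distrib_right by (simp add: mult_ac)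
  finally show ?thesis .
qed

lemma fact_add_mult_le:
  fixes a b m :: nat
  assumes "a \<le> b"
  shows "(fact (a + m) * fact b :: real) \<le> fact a * fact (b + m)"
proof (induction m)
  case (Suc m)
  have "real (a + m + 1) * (fact (a + m) * fact b) \<le> real (b + m + 1) * (fact a * fact (b + m))"
    by (intro mult_mono Suc.IH) (use assms in auto)
  then show ?case by (simp add: algebra_simps)
qed simp

lemma tp2_inverse_fact: "tp2 (toeplitz (\<lambda>i. 1 / fact i))"
proof (rule tp2_toeplitzI)
  fix a b m :: nat assume "a \<le> b"
  then show "1 / fact a * (1 / fact (b + m)) \<le> 1 / fact (a + m) * (1 / fact b :: real)"
    using fact_add_mult_le[of a b m] by (simp add: frac_le)
qed simp

section \<open>Crowded buses\<close>

text \<open>The exponential generating function of the possible loads \<open>\<ge> 2\<close> of a bus.\<close>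

definition crowd :: "real fps" where
  "crowd = Abs_fps (\<lambda>i. if 2 \<le> i then 1 / fact i else 0)"

lemma crowd_nth_nonneg: "0 \<le> fps_nth crowd i"
  by (simp add: crowd_def)

text \<open>Truncation keeps the log-concavity of the inverse factorials: \<open>a\<close> is the
  least of the four indices, so if any is cut off, the left side is 0.\<close>

lemma tp2_crowd: "tp2 (toeplitz (fps_nth crowd))"
proof (rule tp2_toeplitzI)
  fix a b m :: nat assume "a \<le> b"
  then show "fps_nth crowd a * fps_nth crowd (b + m) \<le> fps_nth crowd (a + m) * fps_nth crowd b"
    using fact_add_mult_le[of a b m] by (auto simp: crowd_def frac_le)
qed (rule crowd_nth_nonneg)

text \<open>
  Up to factors depending only on \<open>n\<close> and \<open>k\<close>, \<open>occ n i r / (k - i)!\<close> is the probability of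
  \<open>i\<close> nonempty buses and \<open>r\<close> lonely passengers.
\<close>

definition occ :: "nat \<Rightarrow> nat \<Rightarrow> nat \<Rightarrow> real" where
  "occ n i r = (if r \<le> i \<and> r \<le> n
     then fps_nth (crowd ^ (i - r)) (n - r) / (fact r * fact (i - r)) else 0)"

lemma occ_nonneg: "0 \<le> occ n i r"
  by (simp add: occ_def fps_nth_power_nonneg crowd_nth_nonneg)

text \<open>The coefficients of powers of \<open>crowd\<close> and the reciprocals of
  \<open>fact (i - r)\<close> satisfy the inequality separately; the two are multiplied.\<close>

lemma tp2_occ: "tp2 (occ n)"
  unfolding tp2_def
proof (intro allI impI)
  fix i i' r s :: nat
  assume le: "i \<le> i'" "r \<le> s"
  show "occ n i s * occ n i' r \<le> occ n i r * occ n i' s"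
  proof (cases "s \<le> i \<and> s \<le> n")
    case False
    then have "occ n i s = 0" by (auto simp: occ_def)
    then show ?thesis by (simp add: occ_nonneg)
  next
    case True
    define V where "V = (\<lambda>N j. fps_nth (crowd ^ j) N)"
    \<comment> \<open>Degree \<open>n - r\<close>, exponents \<open>i - r\<close> and
      \<open>i' - r\<close>, shift \<open>t = s - r\<close>.\<close>
    have "V (n - r) (i' - r) * V ((n - r) - (s - r)) ((i - r) - (s - r))
        \<le> V (n - r) (i - r) * V ((n - r) - (s - r)) ((i' - r) - (s - r))"
      unfolding V_def
      by (rule fps_nth_power_diagonal[OF crowd_nth_nonneg tp2_crowd])
         (use le True in \<open>auto simp: crowd_def\<close>)
    then have V: "V (n - r) (i' - r) * V (n - s) (i - s) \<le> V (n - r) (i - r) * V (n - s) (i' - s)"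
      using le True by simp
    have "(fact ((i - s) + (s - r)) * fact (i' - s) :: real) \<le> fact (i - s) * fact ((i' - s) + (s - r))"
      by (rule fact_add_mult_le) (use le in simp)
    then have F: "(fact (i - r) * fact (i' - s) :: real) \<le> fact (i - s) * fact (i' - r)"
      using le True by simp
    have nn: "0 \<le> V N j" for N j
      by (simp add: V_def fps_nth_power_nonneg crowd_nth_nonneg)
    have "(V (n - r) (i' - r) * V (n - s) (i - s)) / (fact r * fact s * (fact (i - s) * fact (i' - r)))
       \<le> (V (n - r) (i - r) * V (n - s) (i' - s)) / (fact r * fact s * (fact (i - r) * fact (i' - s)))"
      by (intro frac_le V mult_left_mono F) (auto intro: nn mult_nonneg_nonneg)
    then show ?thesis using le True by (simp add: occ_def V_def mult_ac)
  qed
qed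

section \<open>Counting boardings by the number of lonely passengers\<close>

lemma sum_Pow_card:
  fixes h :: "nat \<Rightarrow> real"
  assumes "finite A"
  shows "(\<Sum>S\<in>Pow A. h (card S)) = (\<Sum>m=0..card A. real (card A choose m) * h m)"
proof -
  have "(\<Sum>S\<in>Pow A. h (card S)) = (\<Sum>m=0..card A. \<Sum>S | S \<in> Pow A \<and> card S = m. h (card S))"
    by (rule sum.group [symmetric]) (use assms in \<open>auto intro: card_mono\<close>)
  also have "\<dots> = (\<Sum>m=0..card A. real (card A choose m) * h m)"
    using n_subsets[OF assms] by (intro sum.cong) auto
  finally show ?thesis .
qed

text \<open>Here \<open>S\<close> is the fiber over \<open>b\<close>. Resetting the rest of the
  function to \<open>d\<close> on \<open>S\<close> makes the decomposition bijective.\<close>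

lemma sum_PiE_dflt_insert:
  fixes h :: "('a \<Rightarrow> 'b) \<Rightarrow> real"
  assumes "finite A" "finite B" "b \<notin> B"
  shows "(\<Sum>f\<in>PiE_dflt A d (\<lambda>_. insert b B). h f)
       = (\<Sum>S\<in>Pow A. \<Sum>g\<in>PiE_dflt (A - S) d (\<lambda>_. B). h (\<lambda>x. if x \<in> S then b else g x))"
  (is "_ = (\<Sum>S\<in>Pow A. \<Sum>g\<in>?G S. ?h S g)")
proof -
  have "(\<Sum>S\<in>Pow A. \<Sum>g\<in>?G S. ?h S g) = (\<Sum>(S, g)\<in>Sigma (Pow A) ?G. ?h S g)"
    by (rule sum.Sigma) (use assms in \<open>auto intro!: finite_PiE_dflt\<close>)
  also have "\<dots> = (\<Sum>f\<in>PiE_dflt A d (\<lambda>_. insert b B). h f)"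
    by (rule sum.reindex_bij_witness[where
          j = "\<lambda>(S, g) x. if x \<in> S then b else g x" and
          i = "\<lambda>f. ({x \<in> A. f x = b}, \<lambda>x. if x \<in> A \<and> f x \<noteq> b then f x else d)"])
       (use assms in \<open>auto simp: PiE_dflt_def fun_eq_iff split: if_splits\<close>)
  finally show ?thesis ..
qed

text \<open>Product rule for exponential generating functions. Induction removes the fiber over
  \<open>b\<close>, and the binomial coefficient for its choice supplies the factorials;
  \<open>A\<close> varies because the other fibers partition \<open>A - S\<close>.\<close>

lemma sum_prod_fibers:
  fixes \<phi> :: "nat \<Rightarrow> real" and A :: "'a set" and d :: 'b
  assumes "finite B" "finite A"
  shows "(\<Sum>f\<in>PiE_dflt A d (\<lambda>_. B). \<Prod>b\<in>B. \<phi> (card {x \<in> A. f x = b}))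
       = fact (card A) * fps_nth (Abs_fps (\<lambda>i. \<phi> i / fact i) ^ card B) (card A)"
  using assms
proof (induction B arbitrary: A rule: finite_induct)
  case empty
  show ?case
  proof (cases "A = {}")
    case True
    have "PiE_dflt {} d (\<lambda>_. {}) = {\<lambda>_::'a. d :: 'b}" by (auto simp: PiE_dflt_def)
    then show ?thesis using True by simp
  next
    case False
    then have "PiE_dflt A d (\<lambda>_. {}) = {}" by (auto simp: PiE_dflt_def)
    then show ?thesis using False empty by (simp only: sum.empty) simp
  qed
next
  case (insert b B)
  let ?E = "Abs_fps (\<lambda>i. \<phi> i / fact i)"
  let ?n = "card A"
  have "(\<Sum>f\<in>PiE_dflt A d (\<lambda>_. insert b B). \<Prod>c\<in>insert b B. \<phi> (card {x \<in> A. f x = c}))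
      = (\<Sum>S\<in>Pow A. \<Sum>g\<in>PiE_dflt (A - S) d (\<lambda>_. B). \<phi> (card S) * (\<Prod>c\<in>B. \<phi> (card {x \<in> A - S. g x = c})))"
    unfolding sum_PiE_dflt_insert[OF insert.prems insert.hyps(1,2)]
  proof (intro sum.cong refl)
    fix S g assume S: "S \<in> Pow A" and g: "g \<in> PiE_dflt (A - S) d (\<lambda>_. B)"
    let ?f = "\<lambda>x. if x \<in> S then b else g x"
    have "{x \<in> A. ?f x = b} = S"
      using S g insert.hyps(2) by (auto simp: PiE_dflt_def)
    moreover have "{x \<in> A. ?f x = c} = {x \<in> A - S. g x = c}" if "c \<in> B" for c
      using that insert.hyps(2) by auto
    ultimately show "(\<Prod>c\<in>insert b B. \<phi> (card {x \<in> A. ?f x = c}))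
        = \<phi> (card S) * (\<Prod>c\<in>B. \<phi> (card {x \<in> A - S. g x = c}))"
      using insert.hyps by (simp cong: prod.cong)
  qed
  also have "\<dots> = (\<Sum>S\<in>Pow A. \<phi> (card S) * (fact (?n - card S) * fps_nth (?E ^ card B) (?n - card S)))"
  proof (intro sum.cong refl)
    fix S assume "S \<in> Pow A"
    then have "card (A - S) = ?n - card S" "finite (A - S)"
      using insert.prems by (auto intro!: card_Diff_subset intro: finite_subset)
    then show "(\<Sum>g\<in>PiE_dflt (A - S) d (\<lambda>_. B). \<phi> (card S) * (\<Prod>c\<in>B. \<phi> (card {x \<in> A - S. g x = c})))
        = \<phi> (card S) * (fact (?n - card S) * fps_nth (?E ^ card B) (?n - card S))"
      using insert.IH[of "A - S"] by (simp add: sum_distrib_left [symmetric])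
  qed
  also have "\<dots> = (\<Sum>m=0..?n. real (?n choose m) * (\<phi> m * (fact (?n - m) * fps_nth (?E ^ card B) (?n - m))))"
    by (rule sum_Pow_card[OF insert.prems])
  also have "\<dots> = (\<Sum>m=0..?n. fact ?n * (\<phi> m / fact m * fps_nth (?E ^ card B) (?n - m)))"
    by (intro sum.cong refl) (simp add: binomial_fact)
  also have "\<dots> = fact ?n * fps_nth (?E ^ card (insert b B)) ?n"
    using insert.hyps by (simp add: fps_mult_nth sum_distrib_left)
  finally show ?case .
qed


section \<open>Boardings and their generating function\<close>

abbreviation boardings :: "nat \<Rightarrow> nat \<Rightarrow> (nat \<Rightarrow> nat) set" where
  "boardings n k \<equiv> PiE_dflt {..<n} 0 (\<lambda>_. {..<k})"

definition lonely_count :: "nat \<Rightarrow> nat \<Rightarrow> nat \<Rightarrow> nat" where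
  "lonely_count n k r = card {f \<in> boardings n k. num_lonely n f = int r}"

lemma finite_boardings: "finite (boardings n k)"
  by (auto intro!: finite_PiE_dflt)

lemma card_boardings: "card (boardings n k) = k ^ n"
  by (subst card_PiE_dflt) auto

lemma num_lonely_le: "num_lonely n f \<le> int n"
proof -
  have "card {i. lonely n f i} \<le> card {..<n}"
    by (rule card_mono) (auto simp: lonely_def)
  then show ?thesis by (simp add: num_lonely_def)
qed

text \<open>The boarding \<open>f\<close> itself is the bijection. Counting buses instead of
  passengers turns a power of \<open>u\<close> into a product over buses.\<close>

lemma num_lonely_fibers:
  assumes f: "f \<in> boardings n k"
  shows "num_lonely n f = int (card {b \<in> {..<k}. card {x \<in> {..<n}. f x = b} = 1})"
proof -
  have "bij_betw f {i. lonely n f i} {b \<in> {..<k}. card {x \<in> {..<n}. f x = b} = 1}"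
    unfolding bij_betw_def
  proof (intro conjI equalityI subsetI)
    show "inj_on f {i. lonely n f i}"
      by (auto simp: inj_on_def lonely_def)
  next
    fix b assume "b \<in> f ` {i. lonely n f i}"
    then obtain i where i: "lonely n f i" "b = f i" by auto
    then have "{x \<in> {..<n}. f x = b} = {i}" by (auto simp: lonely_def)
    then show "b \<in> {b \<in> {..<k}. card {x \<in> {..<n}. f x = b} = 1}"
      using i f by (auto simp: lonely_def PiE_dflt_def)
  next
    fix b assume "b \<in> {b \<in> {..<k}. card {x \<in> {..<n}. f x = b} = 1}"
    then obtain i where "{x \<in> {..<n}. f x = b} = {i}" by (auto simp: card_1_singleton_iff)
    then have "x < n \<and> f x = b \<longleftrightarrow> x = i" for x by (simp add: set_eq_iff)
    then have "lonely n f i" "f i = b" unfolding lonely_def by metis+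
    then show "b \<in> f ` {i. lonely n f i}" by auto
  qed
  then show ?thesis by (simp add: num_lonely_def bij_betw_same_card)
qed

text \<open>Each bus gets weight \<open>u\<close> for load 1 and weight 1 otherwise, so
  \<open>sum_prod_fibers\<close> applies.\<close>

lemma lonely_count_gf:
  "(\<Sum>r\<le>n. real (lonely_count n k r) * u ^ r)
   = fact n * fps_nth (Abs_fps (\<lambda>i. (if i = 1 then u else 1) / fact i) ^ k) n"
proof -
  let ?\<phi> = "\<lambda>i::nat. if i = 1 then u else 1"
  have "(\<Sum>r\<le>n. real (lonely_count n k r) * u ^ r)
      = (\<Sum>r\<le>n. \<Sum>f | f \<in> boardings n k \<and> nat (num_lonely n f) = r. u ^ nat (num_lonely n f))"
  proof (intro sum.cong refl)
    fix r
    have "{f \<in> boardings n k. num_lonely n f = int r} = {f. f \<in> boardings n k \<and> nat (num_lonely n f) = r}"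
      by (auto simp: num_lonely_def)
    then show "real (lonely_count n k r) * u ^ r
        = (\<Sum>f | f \<in> boardings n k \<and> nat (num_lonely n f) = r. u ^ nat (num_lonely n f))"
      by (simp add: lonely_count_def)
  qed
  also have "\<dots> = (\<Sum>f\<in>boardings n k. u ^ nat (num_lonely n f))"
    by (rule sum.group) (use num_lonely_le in \<open>auto simp: finite_boardings nat_le_iff\<close>)
  also have "\<dots> = (\<Sum>f\<in>boardings n k. \<Prod>b\<in>{..<k}. ?\<phi> (card {x \<in> {..<n}. f x = b}))"
  proof (intro sum.cong refl)
    fix f assume "f \<in> boardings n k"
    then show "u ^ nat (num_lonely n f) = (\<Prod>b\<in>{..<k}. ?\<phi> (card {x \<in> {..<n}. f x = b}))"
      by (simp add: num_lonely_fibers prod.If_cases Int_def)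
  qed
  also have "\<dots> = fact n * fps_nth (Abs_fps (\<lambda>i. ?\<phi> i / fact i) ^ k) n"
    using sum_prod_fibers[of "{..<k}" "{..<n}" ?\<phi> 0] by simp
  finally show ?thesis .
qed

lemma fps_nth_power_add_X:
  fixes a :: "real fps"
  shows "fps_nth ((a + fps_const u * fps_X) ^ k) n
       = (\<Sum>r\<le>n. real (k choose r) * fps_nth (a ^ (k - r)) (n - r) * u ^ r)"
proof -
  have "(a + fps_const u * fps_X) ^ k = (fps_const u * fps_X + a) ^ k"
    by (simp add: add.commute)
  also have "\<dots> = (\<Sum>r\<le>k. fps_const (real (k choose r) * u ^ r) * (fps_X ^ r * a ^ (k - r)))"
    unfolding binomial_ring
    by (intro sum.cong refl)
       (simp add: power_mult_distrib fps_of_nat [symmetric] mult_ac flip: fps_const_mult)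
  finally have "fps_nth ((a + fps_const u * fps_X) ^ k) n
      = (\<Sum>r\<le>k. real (k choose r) * u ^ r * (if n < r then 0 else fps_nth (a ^ (k - r)) (n - r)))"
    by (simp add: fps_sum_nth fps_X_power_mult_nth)
  \<comment> \<open>The binomial coefficient vanishes for \<open>r > k\<close>, the coefficient for
    \<open>r > n\<close>.\<close>
  also have "\<dots> = (\<Sum>r\<le>n. real (k choose r) * fps_nth (a ^ (k - r)) (n - r) * u ^ r)"
    by (rule sum.mono_neutral_cong) auto
  finally show ?thesis .
qed

text \<open>The series of one bus splits into load 0, load 1 (marked by \<open>u\<close>) and loads
  at least 2; coefficients of \<open>u ^ r\<close> are then compared.\<close>

lemma lonely_count_eq_crowd:
  assumes "r \<le> n"
  shows "real (lonely_count n k r) = fact n * real (k choose r) * fps_nth ((1 + crowd) ^ (k - r)) (n - r)"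
proof -
  have E: "Abs_fps (\<lambda>i. (if i = 1 then u else 1) / fact i) = (1 + crowd) + fps_const u * fps_X" for u :: real
    by (rule fps_ext) (auto simp: crowd_def fps_X_def not_le less_2_cases_iff)
  have "\<forall>u. (\<Sum>r\<le>n. real (lonely_count n k r) * u ^ r)
      = (\<Sum>r\<le>n. fact n * real (k choose r) * fps_nth ((1 + crowd) ^ (k - r)) (n - r) * u ^ r)"
    unfolding lonely_count_gf E fps_nth_power_add_X by (simp add: sum_distrib_left mult_ac)
  then show ?thesis
    using assms by (subst (asm) polyfun_eq_coeffs) blast
qed

text \<open>Expanding \<open>(1 + crowd) ^ (k - r)\<close> binomially sums over the number
  \<open>j = i - r\<close> of crowded buses. A free \<open>M\<close> gives different
  \<open>k\<close> a common index range.\<close>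

lemma lonely_count_eq_occ:
  assumes r: "r \<le> n" and M: "k \<le> M"
  shows "real (lonely_count n k r)
       = fact n * fact k * (\<Sum>i\<le>M. toeplitz (\<lambda>i. 1 / fact i) k i * occ n i r)"
proof (cases "r \<le> k")
  case False
  then have "(\<Sum>i\<le>M. toeplitz (\<lambda>i. 1 / fact i) k i * occ n i r) = 0"
    by (intro sum.neutral) (auto simp: toeplitz_def occ_def)
  then show ?thesis using False r by (simp add: lonely_count_eq_crowd)
next
  case True
  have "(\<Sum>i\<le>M. toeplitz (\<lambda>i. 1 / fact i) k i * occ n i r)
      = (\<Sum>i\<in>{r..k}. 1 / fact (k - i) * occ n i r)"
    using M by (intro sum.mono_neutral_cong_right) (auto simp: toeplitz_def occ_def)
  also have "\<dots> = (\<Sum>j\<le>k - r. 1 / fact (k - r - j) * (fps_nth (crowd ^ j) (n - r) / (fact r * fact j)))"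
    by (rule sum.reindex_bij_witness[where i = "\<lambda>j. j + r" and j = "\<lambda>i. i - r"])
       (use True r in \<open>auto simp: occ_def\<close>)
  finally have *: "(\<Sum>i\<le>M. toeplitz (\<lambda>i. 1 / fact i) k i * occ n i r) = \<dots>" .
  have "(1 + crowd) ^ (k - r) = (\<Sum>j\<le>k - r. fps_const (real ((k - r) choose j)) * crowd ^ j)"
    unfolding add.commute[of 1 crowd] binomial_ring by (simp add: fps_of_nat)
  then have "fps_nth ((1 + crowd) ^ (k - r)) (n - r)
      = (\<Sum>j\<le>k - r. real ((k - r) choose j) * fps_nth (crowd ^ j) (n - r))"
    by (simp add: fps_sum_nth)
  then have "real (lonely_count n k r)
      = (\<Sum>j\<le>k - r. fact n * (real (k choose r) * real ((k - r) choose j)) * fps_nth (crowd ^ j) (n - r))"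
    using r by (simp add: lonely_count_eq_crowd sum_distrib_left mult_ac)
  also have "\<dots> = fact n * fact k * (\<Sum>j\<le>k - r. 1 / fact (k - r - j) * (fps_nth (crowd ^ j) (n - r) / (fact r * fact j)))"
    unfolding sum_distrib_left
    by (intro sum.cong refl) (use True in \<open>simp add: binomial_fact\<close>)
  finally show ?thesis using * by simp
qed

text \<open>Monotone likelihood ratio: \<open>tp2_compose\<close> applies to the factorization
  through \<open>i\<close>, and the factorial prefactors agree on both sides.\<close>

lemma lonely_count_lr:
  assumes "k \<le> k'" and "r \<le> s" and "s \<le> n"
  shows "real (lonely_count n k s) * real (lonely_count n k' r)
       \<le> real (lonely_count n k r) * real (lonely_count n k' s)"
proof -
  define P where "P = (\<lambda>k r. \<Sum>i\<le>k'. toeplitz (\<lambda>i. 1 / fact i) k i * occ n i r)"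
  have "P k s * P k' r \<le> P k r * P k' s"
    unfolding P_def by (rule tp2_compose[OF tp2_inverse_fact tp2_occ assms(1,2)])
  then have "(fact n * fact k * (fact n * fact k')) * (P k s * P k' r)
      \<le> (fact n * fact k * (fact n * fact k')) * (P k r * P k' s)"
    by (intro mult_left_mono) auto
  moreover have "real (lonely_count n l q) = fact n * fact l * P l q" if "l \<le> k'" "q \<le> n" for l q
    unfolding P_def by (rule lonely_count_eq_occ) (use that in auto)
  ultimately show ?thesis using assms by (simp add: mult_ac)
qed

text \<open>
  Expanding in powers of \<open>u - 1\<close> gives the factorial moments (times \<open>k ^ n / m!\<close>); the
  linear coefficient yields the expected number of lonely passengers.
\<close>

lemma lonely_count_gf_moments:
  "(\<Sum>r\<le>n. real (lonely_count n k r) * u ^ r)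
   = (\<Sum>m\<le>n. fact n * real (k choose m) * fps_nth (fps_exp (real (k - m))) (n - m) * (u - 1) ^ m)"
proof -
  \<comment> \<open>The weight \<open>u\<close> is \<open>1 + (u - 1)\<close>, which completes the
    exponential series, whose powers are again exponential.\<close>
  have E: "Abs_fps (\<lambda>i. (if i = 1 then u else 1) / fact i) = fps_exp 1 + fps_const (u - 1) * fps_X"
    by (rule fps_ext) (auto simp: fps_X_def)
  show ?thesis
    unfolding lonely_count_gf E fps_nth_power_add_X
    by (simp add: sum_distrib_left mult_ac fps_exp_power_mult)
qed

section \<open>Stochastic dominance\<close>

lemma prob_eq_sum_pmf:
  assumes "set_pmf P \<subseteq> S" "finite S"
  shows "measure_pmf.prob P A = (\<Sum>x\<in>A \<inter> S. pmf P x)"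
proof -
  have "measure_pmf.prob P A = measure_pmf.prob P (A \<inter> S)"
    by (rule measure_pmf.finite_measure_eq_AE) (use assms in \<open>auto simp: AE_measure_pmf_iff\<close>)
  then show ?thesis using assms by (simp add: measure_measure_pmf_finite)
qed

text \<open>Summing \<open>lr\<close> over all pairs \<open>r < t <= s\<close> gives
  \<open>p * (1 - q) <= q * (1 - p)\<close> for the two tails \<open>p\<close> and \<open>q\<close>,
  that is \<open>p <= q\<close>.\<close>

lemma tail_mono_of_likelihood_ratio:
  fixes P Q :: "'a :: linorder pmf"
  assumes P: "set_pmf P \<subseteq> S" and Q: "set_pmf Q \<subseteq> S" and S: "finite S"
    and lr: "\<And>r s. r \<in> S \<Longrightarrow> s \<in> S \<Longrightarrow> r \<le> s \<Longrightarrow> pmf P s * pmf Q r \<le> pmf P r * pmf Q s"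
  shows "measure_pmf.prob P {t..} \<le> measure_pmf.prob Q {t..}"
proof -
  have compl: "measure_pmf.prob M {..<t} = 1 - measure_pmf.prob M {t..}" for M :: "'a pmf"
    using measure_pmf.prob_compl[of "{t..}" M] by (simp add: Compl_eq_Diff_UNIV [symmetric] not_le)
  have "measure_pmf.prob P {t..} * measure_pmf.prob Q {..<t}
      \<le> measure_pmf.prob Q {t..} * measure_pmf.prob P {..<t}"
    unfolding prob_eq_sum_pmf[OF P S] prob_eq_sum_pmf[OF Q S] sum_product
    by (intro sum_mono) (use lr in \<open>auto simp: mult.commute\<close>)
  then show ?thesis by (simp add: compl algebra_simps)
qed

lemma pmf_eq_of_tails_eq:
  fixes P Q :: "int pmf"
  assumes "\<And>r. measure_pmf.prob P {r..} = measure_pmf.prob Q {r..}"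
  shows "P = Q"
proof (rule pmf_eqI)
  fix i
  have "pmf M i = measure_pmf.prob M {i..} - measure_pmf.prob M {i + 1..}" for M :: "int pmf"
  proof -
    have "{i..} - {i + 1..} = {i}" by auto
    then show ?thesis
      using measure_pmf.finite_measure_Diff[of "{i..}" M "{i + 1..}"]
      by (simp add: measure_pmf_single)
  qed
  then show "pmf P i = pmf Q i" using assms by simp
qed

lemma set_pmf_L: "set_pmf (L n k) \<subseteq> int ` {..n}"
proof
  fix x assume "x \<in> set_pmf (L n k)"
  then obtain f where "x = num_lonely n f" by (auto simp: L_def)
  then show "x \<in> int ` {..n}"
    using num_lonely_le[of n f] by (intro image_eqI[of _ _ "nat x"]) (auto simp: num_lonely_def)
qed

lemma pmf_L:
  assumes "k \<ge> 1"
  shows "pmf (L n k) (int r) = real (lonely_count n k r) / real (k ^ n)"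
proof -
  have ne: "{..<k} \<noteq> {}" using assms by (simp add: lessThan_empty_iff)
  have "boarding n k = pmf_of_set (boardings n k)"
    unfolding boarding_def by (rule Pi_pmf_of_set) (use ne in auto)
  moreover have "boardings n k \<noteq> {}"
    using card_boardings[of n k] assms by (metis card.empty not_one_le_zero power_eq_0_iff)
  moreover have "boardings n k \<inter> num_lonely n -` {int r} = {f \<in> boardings n k. num_lonely n f = int r}"
    by auto
  ultimately show ?thesis
    unfolding L_def pmf_map
    by (simp add: measure_pmf_of_set finite_boardings card_boardings lonely_count_def)
qed

text \<open>Equal laws would have equal means, but \<open>(k - 1) / k\<close> strictly increases
  with \<open>k\<close>, and the exponent \<open>n - 1\<close> is positive.\<close>

lemma L_neq:
  assumes "n \<ge> 2" and "k \<ge> 1"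
  shows "L n (k + 1) \<noteq> L n k"
proof
  assume eq: "L n (k + 1) = L n k"
  \<comment> \<open>For \<open>l >= 1\<close> this is the expected number of
    \<open>m\<close>-element sets of lonely passengers; \<open>c l 1\<close> is the mean.\<close>
  define c where "c = (\<lambda>l m. fact n * real (l choose m) * fps_nth (fps_exp (real (l - m))) (n - m) / real (l ^ n))"
  have gf: "(\<Sum>m\<le>n. c l m * v ^ m) = (\<Sum>r\<le>n. pmf (L n l) (int r) * (v + 1) ^ r)" if "l \<ge> 1" for l v
    using arg_cong[OF lonely_count_gf_moments[of n l "v + 1"], of "\<lambda>x. x / real (l ^ n)"]
    by (simp add: pmf_L[OF that] c_def sum_divide_distrib)
  have "\<forall>v. (\<Sum>m\<le>n. c (k + 1) m * v ^ m) = (\<Sum>m\<le>n. c k m * v ^ m)"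
    using gf[of k] gf[of "k + 1"] assms eq by simp
  then have "c (k + 1) 1 = c k 1"
    using assms by (subst (asm) polyfun_eq_coeffs) auto
  moreover have "c l 1 = real n * ((real l - 1) / real l) ^ (n - 1)" if "l \<ge> 1" for l
  proof -
    obtain m where m: "n = Suc m" using assms by (cases n) auto
    show ?thesis using that by (simp add: c_def m power_divide of_nat_diff)
  qed
  ultimately have "(real k / real (k + 1)) ^ (n - 1) = ((real k - 1) / real k) ^ (n - 1)"
    using assms by simp
  moreover have "((real k - 1) / real k) ^ (n - 1) < (real k / real (k + 1)) ^ (n - 1)"
    using assms by (intro power_strict_mono) (auto simp: field_simps)
  ultimately show False by simp
qed

theorem theorem2:
  fixes n k :: nat
  assumes "n \<ge> 2" and "k \<ge> 1"
  shows "L n (k + 1) \<succ> L n k"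
proof -
  have le: "measure_pmf.prob (L n k) {t..} \<le> measure_pmf.prob (L n (k + 1)) {t..}" for t
  proof (rule tail_mono_of_likelihood_ratio[OF set_pmf_L set_pmf_L])
    fix r s assume "r \<in> int ` {..n}" "s \<in> int ` {..n}" "r \<le> s"
    then obtain r' s' where rs: "r = int r'" "s = int s'" "r' \<le> s'" "s' \<le> n" by auto
    have "real (lonely_count n k s') * real (lonely_count n (k + 1) r') / (real (k ^ n) * real ((k + 1) ^ n))
       \<le> real (lonely_count n k r') * real (lonely_count n (k + 1) s') / (real (k ^ n) * real ((k + 1) ^ n))"
      by (intro divide_right_mono lonely_count_lr) (use rs in auto)
    then show "pmf (L n k) s * pmf (L n (k + 1)) r \<le> pmf (L n k) r * pmf (L n (k + 1)) s"
      using pmf_L[of k n] pmf_L[of "k + 1" n] assms rs by simp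
  qed simp
  \<comment> \<open>If no tail inequality were strict, all tails would agree and so would the
    laws.\<close>
  moreover have "\<exists>t. measure_pmf.prob (L n k) {t..} < measure_pmf.prob (L n (k + 1)) {t..}"
    using pmf_eq_of_tails_eq[of "L n k" "L n (k + 1)"] L_neq[OF assms] le
    by (metis order.not_eq_order_implies_strict)
  ultimately show ?thesis by (simp add: strictly_dominates_def)
qed

end
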